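(* Fix a prompt $x\in X$ and define, for $m\in\mathbb{R}$, $$F_x(m)=\mathbb{E}_{y\sim\rho_{\mathrm{base}}(\cdot\mid x)}\Big[w_{x,y}(m)\,\big(r_U(x,y)-m\big)\Big],\qquad w_{x,y}(m)=\begin{cases}1 & \text{if } r_U(x,y)<m,\\ \exp(B/\beta)&\text{if } r_U(x,y)\ge m.\end{cases}$$ Then $F_x$ is continuous and strictly decreasing in $m$, and $F_x(m)=0$ has a unique solution. This solution equals the optimal threshold $m^*(x)$, which solves $$m^*(x)=\mathbb{E}_{y\sim\rho_{r_{m^*}}(\cdot\mid x)}\big[r_U(x,y)\big],$$ where $r_{m^*}$ is the threshold reward model with threshold $m^*$ .
   Context: $X$ is a set of prompts, $Y$ a (measurable) space of responses, and $\rho_{\mathrm{base}}(\cdot\mid x)$ a probability distribution on $Y$ for each $x\in X$. $r_U:X\times Y\to\mathbb{R}$ is the user's utility function, with $r_U(x,\cdot)$ integrable under $\rho_{\mathrm{base}}(\cdot\mid x)$; $B>0$ and $\beta>0$ are constants. For a (measurable, bounded) reward model $r:X\times Y\to\mathbb{R}$, the KL-regularized best response $\rho_r(\cdot\mid x)$ is the distribution with density $\exp(r(x,y)/\beta)/Z_r(x)$ with respect to $\rho_{\mathrm{base}}(\cdot\mid x)$, where $Z_r(x)=\mathbb{E}_{y\sim\rho_{\mathrm{base}}(\cdot\mid x)}[\exp(r(x,y)/\beta)]$. Given $m:X\to\mathbb{R}$, a threshold reward model $r_m$ is a reward model with $r_m(x,y)=0$ if $r_U(x,y)<m(x)$, $r_m(x,y)=B$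 if $r_U(x,y)>m(x)$, and $r_m(x,y)\in[0,B]$ (any value) if $r_U(x,y)=m(x)$. The optimal threshold $m^*(x)$ is the threshold satisfying the displayed fixed-point equation for which $r_{m^*}$ maximizes $\mathbb{E}_{y\sim\rho_r(\cdot\mid x)}[r_U(x,y)]$ over all reward models $r$ with $0\le r(x,y)\le B$ for all $y$. *)

theory Defs
  imports "HOL-Probability.Probability"
begin

text \<open>
  Prompts are the elements of the type \<open>'x\<close>, which carries no sigma-algebra: measurability
  of a reward model is required in the response only.
  Responses are the points of the measurable space \<open>Y\<close>, and \<open>\<rho> x\<close> is the base policy at prompt \<open>x\<close>.
\<close>

definition reward_model :: "'y measure \<Rightarrow> ('x \<Rightarrow> 'y \<Rightarrow> real) \<Rightarrow> bool" where
  "reward_model Y r \<longleftrightarrow>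
     (\<forall>x. r x \<in> borel_measurable Y) \<and> (\<exists>C. \<forall>x. \<forall>y\<in>space Y. \<bar>r x y\<bar> \<le> C)"

definition partition_function ::
  "('x \<Rightarrow> 'y measure) \<Rightarrow> real \<Rightarrow> ('x \<Rightarrow> 'y \<Rightarrow> real) \<Rightarrow> 'x \<Rightarrow> real" where
  "partition_function \<rho> \<beta> r x = (LINT y|\<rho> x. exp (r x y / \<beta>))"

definition best_response ::
  "('x \<Rightarrow> 'y measure) \<Rightarrow> real \<Rightarrow> ('x \<Rightarrow> 'y \<Rightarrow> real) \<Rightarrow> 'x \<Rightarrow> 'y measure" where
  "best_response \<rho> \<beta> r x =
     density (\<rho> x) (\<lambda>y. ennreal (exp (r x y / \<beta>) / partition_function \<rho> \<beta> r x))"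

definition expected_utility ::
  "('x \<Rightarrow> 'y measure) \<Rightarrow> ('x \<Rightarrow> 'y \<Rightarrow> real) \<Rightarrow> real \<Rightarrow> 'x \<Rightarrow> ('x \<Rightarrow> 'y \<Rightarrow> real) \<Rightarrow> real" where
  "expected_utility \<rho> rU \<beta> x r = (LINT y|best_response \<rho> \<beta> r x. rU x y)"

text \<open>
  A relation rather than a function of \<open>m\<close>, because the values on ties \<open>rU x y = m x\<close> are
  arbitrary in \<open>[0, B]\<close>.
\<close>

definition threshold_reward_model ::
  "'y measure \<Rightarrow> ('x \<Rightarrow> 'y \<Rightarrow> real) \<Rightarrow> real \<Rightarrow> ('x \<Rightarrow> real) \<Rightarrow> ('x \<Rightarrow> 'y \<Rightarrow> real) \<Rightarrow> bool" where
  "threshold_reward_model Y rU B m r \<longleftrightarrow>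
     reward_model Y r \<and>
     (\<forall>x. \<forall>y\<in>space Y.
        (rU x y < m x \<longrightarrow> r x y = 0) \<and>
        (rU x y > m x \<longrightarrow> r x y = B) \<and>
        (rU x y = m x \<longrightarrow> r x y \<in> {0..B}))"

text \<open>
  \<open>m x\<close> is an optimal threshold at the prompt \<open>x\<close>, for some choice of the values on ties.
\<close>

definition optimal_threshold ::
  "'y measure \<Rightarrow> ('x \<Rightarrow> 'y measure) \<Rightarrow> ('x \<Rightarrow> 'y \<Rightarrow> real) \<Rightarrow> real \<Rightarrow> real \<Rightarrow> 'x \<Rightarrow> ('x \<Rightarrow> real) \<Rightarrow> bool" where
  "optimal_threshold Y \<rho> rU B \<beta> x m \<longleftrightarrow>
     (\<exists>r. threshold_reward_model Y rU B m r \<and>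
          m x = expected_utility \<rho> rU \<beta> x r \<and>
          is_arg_max (expected_utility \<rho> rU \<beta> x)
            (\<lambda>r'. reward_model Y r' \<and> (\<forall>y\<in>space Y. 0 \<le> r' x y \<and> r' x y \<le> B)) r)"

definition threshold_weight ::
  "('x \<Rightarrow> 'y \<Rightarrow> real) \<Rightarrow> real \<Rightarrow> real \<Rightarrow> 'x \<Rightarrow> 'y \<Rightarrow> real \<Rightarrow> real" where
  "threshold_weight rU B \<beta> x y m = (if rU x y < m then 1 else exp (B / \<beta>))"

definition threshold_gap ::
  "('x \<Rightarrow> 'y measure) \<Rightarrow> ('x \<Rightarrow> 'y \<Rightarrow> real) \<Rightarrow> real \<Rightarrow> real \<Rightarrow> 'x \<Rightarrow> real \<Rightarrow> real" where
  "threshold_gap \<rho> rU B \<beta> x m =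
     (LINT y|\<rho> x. threshold_weight rU B \<beta> x y m * (rU x y - m))"

end

theory Submission
  imports Defs
begin

text \<open>
  Put \<open>K = exp (B / \<beta>)\<close>. Since \<open>K \<ge> 1\<close>, the integrand of \<open>F\<^sub>x(m)\<close> is \<open>h (r\<^sub>U - m)\<close> with
  \<open>h t = max t (K t)\<close>, whose slopes lie between \<open>1\<close> and \<open>K\<close>. Hence \<open>F\<^sub>x\<close> is Lipschitz and decreases
  at least at unit rate, so it has exactly one zero. For every reward \<open>r\<close> with values in \<open>[0, B]\<close>
  the weight \<open>exp (r / \<beta>)\<close> lies in \<open>[1, K]\<close>, so \<open>exp (r / \<beta>) (r\<^sub>U - c) \<le> h (r\<^sub>U - c)\<close>, with equality
  for threshold rewards at \<open>c\<close>. After integration, the expected utility \<open>E\<^sub>r\<close> satisfies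
  \<open>Z\<^sub>r (E\<^sub>r - c) \<le> F\<^sub>x(c)\<close>, with equality for threshold rewards at \<open>c\<close>; this gives both the fixed-point
  equation and optimality when \<open>F\<^sub>x(c) = 0\<close>.
\<close>

text \<open>The function \<open>u + (K - 1) * max u 0\<close> is another form of
  \<open>max u (K * u)\<close>, and the positive part \<open>max u 0\<close> is nondecreasing and
  1-Lipschitz.\<close>

lemma max_scale_diff_bounds:
  fixes K s t :: real
  assumes "K \<ge> 1" "s \<le> t"
  shows "t - s \<le> max t (K * t) - max s (K * s)"
    and "max t (K * t) - max s (K * s) \<le> K * (t - s)"
proof -
  have *: "max u (K * u) = u + (K - 1) * max u 0" for u
  proof (cases "u \<ge> 0")
    case True
    then have "u \<le> K * u" using assms(1) mult_right_mono[of 1 K u] by simp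
    then show ?thesis using True by (simp add: max_def algebra_simps)
  next
    case False
    then have "K * u \<le> u" using assms(1) mult_right_mono_neg[of 1 K u] by simp
    then show ?thesis using False by (simp add: max_def)
  qed
  have "0 \<le> max t 0 - max s 0" "max t 0 - max s 0 \<le> t - s"
    using assms(2) by auto
  then have "0 \<le> (K - 1) * (max t 0 - max s 0)"
    "(K - 1) * (max t 0 - max s 0) \<le> (K - 1) * (t - s)"
    using assms(1) by (auto intro: mult_left_mono)
  then show "t - s \<le> max t (K * t) - max s (K * s)"
    and "max t (K * t) - max s (K * s) \<le> K * (t - s)"
    unfolding * by (auto simp: algebra_simps)
qed

text \<open>For \<open>t \<ge> 0\<close> the largest admissible weight \<open>K\<close> is best, for
  \<open>t < 0\<close> the smallest weight \<open>1\<close>. This pointwise comparison is what makes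
  threshold rewards optimal.\<close>

lemma weight_mult_le_max:
  fixes K w t :: real
  assumes "1 \<le> w" "w \<le> K"
  shows "w * t \<le> max t (K * t)"
proof (cases "t \<ge> 0")
  case True
  then show ?thesis using mult_right_mono[OF assms(2)] by (simp add: le_max_iff_disj)
next
  case False
  then show ?thesis using mult_right_mono_neg[OF assms(1), of t] by (simp add: le_max_iff_disj)
qed

text \<open>As \<open>exp (B / \<beta>) \<ge> 1\<close>, the maximum selects the scaled term exactly
  when \<open>rU x y - m\<close> is positive; at a tie both terms are \<open>0\<close>. The jump of
  the weight thus leaves the integrand continuous in \<open>m\<close>.\<close>

lemma threshold_gap_eq_max:
  assumes "B \<ge> 0" "\<beta> > 0"
  shows "threshold_gap \<rho> rU B \<beta> x m =
    (LINT y|\<rho> x. max (rU x y - m) (exp (B / \<beta>) * (rU x y - m)))"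
proof -
  have K: "exp (B / \<beta>) \<ge> 1" using assms by simp
  have "threshold_weight rU B \<beta> x y m * (rU x y - m) =
      max (rU x y - m) (exp (B / \<beta>) * (rU x y - m))" for y
    using mult_right_mono[OF K, of "rU x y - m"] mult_right_mono_neg[OF K, of "rU x y - m"]
    by (auto simp: threshold_weight_def max_def)
  then show ?thesis by (simp add: threshold_gap_def)
qed

text \<open>The slope bounds hold for each response and survive averaging over a probability
  measure. The lower bound yields strict decrease and the zero, the upper one continuity.\<close>

lemma threshold_gap_diff_bounds:
  assumes "prob_space (\<rho> x)" "integrable (\<rho> x) (rU x)" "B \<ge> 0" "\<beta> > 0" "a \<le> b"
  shows "b - a \<le> threshold_gap \<rho> rU B \<beta> x a - threshold_gap \<rho> rU B \<beta> x b"
    and "threshold_gap \<rho> rU B \<beta> x a - threshold_gap \<rho> rU B \<beta> x b \<le> exp (B / \<beta>) * (b - a)"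
proof -
  interpret prob_space "\<rho> x" by fact
  define K where "K = exp (B / \<beta>)"
  define h where "h m y = max (rU x y - m) (K * (rU x y - m))" for m y
  have K: "K \<ge> 1" using assms by (simp add: K_def)
  have int: "integrable (\<rho> x) (h m)" for m
    unfolding h_def using assms(2) by (intro integrable_max) auto
  have eq: "threshold_gap \<rho> rU B \<beta> x a - threshold_gap \<rho> rU B \<beta> x b = expectation (\<lambda>y. h a y - h b y)"
    using int by (simp add: threshold_gap_eq_max assms h_def K_def)
  have bounds: "b - a \<le> h a y - h b y" "h a y - h b y \<le> K * (b - a)" for y
    using max_scale_diff_bounds[OF K, of "rU x y - b" "rU x y - a"] assms(5)
    by (auto simp: h_def)
  have "integrable (\<rho> x) (\<lambda>y. h a y - h b y)" using int by simp
  then show "b - a \<le> threshold_gap \<rho> rU B \<beta> x a - threshold_gap \<rho> rU B \<beta> x b"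
    and "threshold_gap \<rho> rU B \<beta> x a - threshold_gap \<rho> rU B \<beta> x b \<le> exp (B / \<beta>) * (b - a)"
    unfolding eq K_def[symmetric] using bounds
    by (auto intro!: integral_ge_const integral_le_const)
qed

lemma continuous_threshold_gap:
  assumes "prob_space (\<rho> x)" "integrable (\<rho> x) (rU x)" "B \<ge> 0" "\<beta> > 0"
  shows "continuous_on UNIV (threshold_gap \<rho> rU B \<beta> x)"
proof -
  let ?F = "threshold_gap \<rho> rU B \<beta> x"
  have le: "dist (?F a) (?F b) \<le> exp (B / \<beta>) * dist a b" if "a \<le> b" for a b
    using threshold_gap_diff_bounds[where \<rho> = \<rho> and x = x and rU = rU, OF assms that] that by (auto simp: dist_real_def)
  have "(exp (B / \<beta>))-lipschitz_on UNIV ?F"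
  proof (rule lipschitz_onI)
    fix a b :: real
    show "dist (?F a) (?F b) \<le> exp (B / \<beta>) * dist a b"
      using le[of a b] le[of b a] by (cases a b rule: linorder_cases) (auto simp: dist_commute)
  qed simp
  then show ?thesis by (rule lipschitz_on_continuous_on)
qed

lemma strict_antimono_threshold_gap:
  assumes "prob_space (\<rho> x)" "integrable (\<rho> x) (rU x)" "B \<ge> 0" "\<beta> > 0"
  shows "strict_antimono_on UNIV (threshold_gap \<rho> rU B \<beta> x)"
proof (rule monotone_onI)
  fix a b :: real
  assume "a < b"
  then show "threshold_gap \<rho> rU B \<beta> x b < threshold_gap \<rho> rU B \<beta> x a"
    using threshold_gap_diff_bounds(1)[where \<rho> = \<rho> and x = x and rU = rU, OF assms, of a b] by linarith
qed

lemma ex1_threshold_gap_zero: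
  assumes "prob_space (\<rho> x)" "integrable (\<rho> x) (rU x)" "B \<ge> 0" "\<beta> > 0"
  shows "\<exists>!c. threshold_gap \<rho> rU B \<beta> x c = 0"
proof -
  let ?F = "threshold_gap \<rho> rU B \<beta> x"
  \<comment> \<open>Decrease at unit rate or faster means that moving a distance
    \<open>\<bar>?F 0\<bar>\<close> from \<open>0\<close>, to the right or to the left, suffices to
    reach a value of the required sign.\<close>
  define b where "b = \<bar>?F 0\<bar>"
  have "?F b \<le> 0" "0 \<le> ?F (- b)"
    using threshold_gap_diff_bounds(1)[where \<rho> = \<rho> and x = x and rU = rU, OF assms, of 0 b]
      threshold_gap_diff_bounds(1)[where \<rho> = \<rho> and x = x and rU = rU, OF assms, of "- b" 0] by (auto simp: b_def)
  then obtain c where "?F c = 0"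
    using IVT2'[of ?F b 0 "- b"] continuous_on_subset[OF continuous_threshold_gap[where \<rho> = \<rho> and x = x and rU = rU, OF assms]]
    by (auto simp: b_def)
  moreover have "a = c" if "?F a = 0" for a
    using threshold_gap_diff_bounds(1)[where \<rho> = \<rho> and x = x and rU = rU, OF assms, of a c]
      threshold_gap_diff_bounds(1)[where \<rho> = \<rho> and x = x and rU = rU, OF assms, of c a] that \<open>?F c = 0\<close> by linarith
  ultimately show ?thesis by blast
qed

context
  fixes \<rho> :: "'x \<Rightarrow> 'y measure" and rU r :: "'x \<Rightarrow> 'y \<Rightarrow> real" and B \<beta> :: real and x :: 'x
  assumes prob: "prob_space (\<rho> x)"
    and int_rU: "integrable (\<rho> x) (rU x)"
    and beta: "\<beta> > 0"
    and meas: "r x \<in> borel_measurable (\<rho> x)"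
    and range: "\<And>y. y \<in> space (\<rho> x) \<Longrightarrow> 0 \<le> r x y \<and> r x y \<le> B"
begin

interpretation prob_space "\<rho> x" by (rule prob)

lemma exp_reward_bounds:
  assumes "y \<in> space (\<rho> x)"
  shows "1 \<le> exp (r x y / \<beta>)" "exp (r x y / \<beta>) \<le> exp (B / \<beta>)"
  using range[OF assms] beta by (auto simp: divide_right_mono)

lemma integrable_exp_reward: "integrable (\<rho> x) (\<lambda>y. exp (r x y / \<beta>))"
  by (rule integrable_const_bound[where B = "exp (B / \<beta>)"])
    (use exp_reward_bounds meas in \<open>auto intro!: AE_I2\<close>)

text \<open>Positivity of the normalizer allows it to be cancelled, and makes the sign of
  \<open>expected_utility \<rho> rU \<beta> x r - c\<close> readable from an integral under the base
  policy.\<close>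

lemma partition_function_ge_1: "1 \<le> partition_function \<rho> \<beta> r x"
  unfolding partition_function_def
  by (rule integral_ge_const[OF integrable_exp_reward]) (use exp_reward_bounds in auto)

lemma integrable_exp_reward_mult:
  assumes "integrable (\<rho> x) f"
  shows "integrable (\<rho> x) (\<lambda>y. exp (r x y / \<beta>) * f y)"
proof (rule Bochner_Integration.integrable_bound)
  show "integrable (\<rho> x) (\<lambda>y. exp (B / \<beta>) * f y)" using assms by simp
  show "(\<lambda>y. exp (r x y / \<beta>) * f y) \<in> borel_measurable (\<rho> x)" using meas assms by measurable
  show "AE y in \<rho> x. norm (exp (r x y / \<beta>) * f y) \<le> norm (exp (B / \<beta>) * f y)"
    using exp_reward_bounds(2) by (auto simp: abs_mult intro!: mult_right_mono)
qed

text \<open>Clearing the normalizer turns the expectation under the best response into one under the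
  base policy; \<open>c\<close> moves inside because the normalizer is itself the integral of the
  weight.\<close>

lemma partition_function_mult_expected_utility_diff:
  "partition_function \<rho> \<beta> r x * (expected_utility \<rho> rU \<beta> x r - c) =
    (LINT y|\<rho> x. exp (r x y / \<beta>) * (rU x y - c))"
proof -
  let ?Z = "partition_function \<rho> \<beta> r x"
  have Z: "?Z \<ge> 1" by (rule partition_function_ge_1)
  have "expected_utility \<rho> rU \<beta> x r = (LINT y|\<rho> x. (exp (r x y / \<beta>) / ?Z) *\<^sub>R rU x y)"
    unfolding expected_utility_def best_response_def
    by (rule integral_density) (use meas int_rU Z in auto)
  also have "\<dots> = (LINT y|\<rho> x. exp (r x y / \<beta>) * rU x y) / ?Z" by simp
  finally have "?Z * expected_utility \<rho> rU \<beta> x r = (LINT y|\<rho> x. exp (r x y / \<beta>) * rU x y)"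
    using Z by simp
  moreover have "(LINT y|\<rho> x. exp (r x y / \<beta>) * (rU x y - c)) =
      (LINT y|\<rho> x. exp (r x y / \<beta>) * rU x y) - ?Z * c"
    using integrable_exp_reward integrable_exp_reward_mult[OF int_rU]
    by (simp add: right_diff_distrib partition_function_def)
  ultimately show ?thesis by (simp add: right_diff_distrib)
qed

lemma partition_function_mult_expected_utility_diff_le:
  assumes "B \<ge> 0"
  shows "partition_function \<rho> \<beta> r x * (expected_utility \<rho> rU \<beta> x r - c) \<le> threshold_gap \<rho> rU B \<beta> x c"
  unfolding partition_function_mult_expected_utility_diff threshold_gap_eq_max[OF assms beta]
proof (rule integral_mono)
  show "integrable (\<rho> x) (\<lambda>y. exp (r x y / \<beta>) * (rU x y - c))"
    by (rule integrable_exp_reward_mult) (use int_rU in simp)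
  show "integrable (\<rho> x) (\<lambda>y. max (rU x y - c) (exp (B / \<beta>) * (rU x y - c)))"
    using int_rU by (intro integrable_max) auto
qed (intro weight_mult_le_max exp_reward_bounds)

lemma expected_utility_le_gap_zero:
  assumes "B \<ge> 0" "threshold_gap \<rho> rU B \<beta> x c = 0"
  shows "expected_utility \<rho> rU \<beta> x r \<le> c"
  using partition_function_mult_expected_utility_diff_le[OF assms(1), of c] partition_function_ge_1
  by (simp add: assms(2) mult_le_0_iff)

text \<open>Off ties the weight \<open>exp (r x y / \<beta>)\<close> equals
  \<open>threshold_weight\<close>, and on ties the factor \<open>rU x y - c\<close> vanishes. Hence
  the gap at \<open>c\<close> is the positive normalizer times
  \<open>expected_utility \<rho> rU \<beta> x r - c\<close>.\<close>

lemma threshold_gap_zero_iff_fixed_point: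
  assumes "\<And>y. y \<in> space (\<rho> x) \<Longrightarrow> rU x y < c \<Longrightarrow> r x y = 0"
    and "\<And>y. y \<in> space (\<rho> x) \<Longrightarrow> rU x y > c \<Longrightarrow> r x y = B"
  shows "threshold_gap \<rho> rU B \<beta> x c = 0 \<longleftrightarrow> c = expected_utility \<rho> rU \<beta> x r"
proof -
  have "(LINT y|\<rho> x. exp (r x y / \<beta>) * (rU x y - c)) = threshold_gap \<rho> rU B \<beta> x c"
    unfolding threshold_gap_def threshold_weight_def
    by (rule Bochner_Integration.integral_cong) (auto simp: assms not_less le_less)
  then show ?thesis
    using partition_function_mult_expected_utility_diff[of c] partition_function_ge_1 by auto
qed

end

text \<open>Supplies the witness for the existential in \<open>optimal_threshold\<close>. Ties
  receive \<open>B\<close>, in line with the convention of \<open>threshold_weight\<close>.\<close>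

lemma threshold_reward_model_step:
  assumes "B \<ge> 0" "\<And>x. rU x \<in> borel_measurable Y"
  shows "threshold_reward_model Y rU B m (\<lambda>x y. if rU x y < m x then 0 else B)"
  using assms unfolding threshold_reward_model_def reward_model_def
  by (auto intro!: exI[of _ B])

lemma threshold_reward_model_range:
  assumes "threshold_reward_model Y rU B m r" "B \<ge> 0" "y \<in> space Y"
  shows "0 \<le> r x y \<and> r x y \<le> B"
  using assms unfolding threshold_reward_model_def
  by (cases "rU x y" "m x" rule: linorder_cases) auto

text \<open>The last conjunct extends the fixed-point equation from the one choice of tie values
  provided by \<open>optimal_threshold\<close> to all of them.\<close>

theorem theorem2:
  fixes Y :: "'y measure"
    and \<rho> :: "'x \<Rightarrow> 'y measure"
    and rU :: "'x \<Rightarrow> 'y \<Rightarrow> real"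
    and B \<beta> :: real
    and x :: 'x
  assumes "\<And>x. prob_space (\<rho> x)"
    and "\<And>x. sets (\<rho> x) = sets Y"
    and "\<And>x. integrable (\<rho> x) (rU x)"
    and "B > 0"
    and "\<beta> > 0"
  shows "continuous_on UNIV (threshold_gap \<rho> rU B \<beta> x) \<and>
         strict_antimono_on UNIV (threshold_gap \<rho> rU B \<beta> x) \<and>
         (\<exists>!c. threshold_gap \<rho> rU B \<beta> x c = 0) \<and>
         (\<forall>m. threshold_gap \<rho> rU B \<beta> x (m x) = 0 \<longleftrightarrow> optimal_threshold Y \<rho> rU B \<beta> x m) \<and>
         (\<forall>m r. optimal_threshold Y \<rho> rU B \<beta> x m \<and> threshold_reward_model Y rU B m r \<longrightarrow>
            m x = expected_utility \<rho> rU \<beta> x r)"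
proof -
  let ?F = "threshold_gap \<rho> rU B \<beta> x" and ?E = "expected_utility \<rho> rU \<beta> x"
  have B: "B \<ge> 0" using assms(4) by simp
  have sp: "space (\<rho> x) = space Y" by (rule sets_eq_imp_space_eq) (rule assms(2))
  have meas: "f \<in> borel_measurable (\<rho> x') \<longleftrightarrow> f \<in> borel_measurable Y" for f :: "'y \<Rightarrow> real" and x'
    by (simp add: measurable_cong_sets[OF assms(2) refl])
  have rU: "rU x' \<in> borel_measurable Y" for x'
    using borel_measurable_integrable[OF assms(3)] by (simp add: meas)
  have fixed_point: "?F (m x) = 0 \<longleftrightarrow> m x = ?E r" if "threshold_reward_model Y rU B m r" for m r
  proof (rule threshold_gap_zero_iff_fixed_point[where \<rho> = \<rho> and x = x and rU = rU, OF assms(1,3,5)])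
    show "r x \<in> borel_measurable (\<rho> x)"
      using that by (simp add: threshold_reward_model_def reward_model_def meas)
  qed (use that threshold_reward_model_range[OF that B] sp in \<open>auto simp: threshold_reward_model_def\<close>)
  have upper: "?E r \<le> c"
    if "?F c = 0" "reward_model Y r" "\<forall>y\<in>space Y. 0 \<le> r x y \<and> r x y \<le> B" for c r
  proof (rule expected_utility_le_gap_zero[where \<rho> = \<rho> and x = x and rU = rU, OF assms(1,3,5) _ _ B that(1)])
    show "r x \<in> borel_measurable (\<rho> x)" using that(2) by (simp add: reward_model_def meas)
  qed (use that(3) sp in auto)
  have iff: "?F (m x) = 0 \<longleftrightarrow> optimal_threshold Y \<rho> rU B \<beta> x m" for m
  proof
    assume zero: "?F (m x) = 0"
    let ?r = "\<lambda>x y. if rU x y < m x then 0 else B"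
    have thr: "threshold_reward_model Y rU B m ?r"
      by (rule threshold_reward_model_step[OF B rU])
    have fp: "m x = ?E ?r" using fixed_point[OF thr] zero by simp
    have "reward_model Y ?r" using thr by (simp add: threshold_reward_model_def)
    \<comment> \<open>Every competitor has utility at most the zero \<open>m x\<close> of the gap,
      and the step model attains this value.\<close>
    moreover have "\<not> ?E ?r < ?E r"
      if "reward_model Y r" "\<forall>y\<in>space Y. 0 \<le> r x y \<and> r x y \<le> B" for r
      using upper[OF zero that] fp by linarith
    ultimately have "is_arg_max ?E
        (\<lambda>r'. reward_model Y r' \<and> (\<forall>y\<in>space Y. 0 \<le> r' x y \<and> r' x y \<le> B)) ?r"
      using B by (auto simp: is_arg_max_def)
    with thr fp show "optimal_threshold Y \<rho> rU B \<beta> x m"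
      unfolding optimal_threshold_def by blast
  next
    assume "optimal_threshold Y \<rho> rU B \<beta> x m"
    then show "?F (m x) = 0" using fixed_point unfolding optimal_threshold_def by blast
  qed
  show ?thesis
    using continuous_threshold_gap[where \<rho> = \<rho> and x = x and rU = rU, OF assms(1,3) B assms(5)]
      strict_antimono_threshold_gap[where \<rho> = \<rho> and x = x and rU = rU, OF assms(1,3) B assms(5)]
      ex1_threshold_gap_zero[where \<rho> = \<rho> and x = x and rU = rU, OF assms(1,3) B assms(5)] iff fixed_point
    by blast
qed

end
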